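(* Let the correlations of the bivariate Gaussian triangular array satisfy $\rho_n\in(0,1]$ and assume that $$\lim_{n\to\infty}b_n^6(1-\rho_n)=0 .$$ Then for all $x>0$, $y>0$, $$\lim_{n\to\infty}b_n^2\left(F_n^{\,n}\big(b_nx^{b_n^{-2}},\,b_ny^{b_n^{-2}}\big)-H_0(\ln x,\ln y)\right)=s(\min(x,y))\,H_0(\ln x,\ln y),$$ where $s(x)=\big((\ln x)^2+\ln x\big)x^{-1}$.
   Context: $\Phi$ denotes the standard normal distribution function. The norming constants $b_n$ are defined by $n(1-\Phi(b_n))=1$ (for $n\ge 3$, so $b_n>0$ and $b_n\to\infty$). $\{(X_{n,k},Y_{n,k}):1\le k\le n,\ n\ge1\}$ is a triangular array of independent standard bivariate Gaussian random vectors (zero means, unit variances); all vectors in row $n$ have correlation $\rho_n$, and $F_n$ denotes their common joint distribution function, $F_n(s,t)=\mathbb{P}(X_{n,1}\le s,Y_{n,1}\le t)$. Thus $F_n^{\,n}(s,t)=(F_n(s,t))^n$ is the joint distribution function of the componentwise maxima of row $n$. $H_0(s,t)=\exp(-e^{-\min(s,t)})$ for $s,t\in\mathbb{R}$, so $H_0(\ln x,\ln y)=\exp\big(-(\min(x,y))^{-1}\big)$ for $x,y>0$. *)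

theory Defs
  imports "HOL-Probability.Probability"
begin

definition std_normal_cdf :: "real \<Rightarrow> real" where
  "std_normal_cdf = cdf std_normal_distribution"

(* (X, Y) is Gaussian if its law is the law of an affine image m + A Z of a pair Z of independent
   standard normal variables. A may be singular, so degenerate laws (correlation 1) are included. *)
definition gaussian_vector :: "'a measure \<Rightarrow> ('a \<Rightarrow> real) \<Rightarrow> ('a \<Rightarrow> real) \<Rightarrow> bool" where
  "gaussian_vector M X Y \<longleftrightarrow>
     X \<in> borel_measurable M \<and> Y \<in> borel_measurable M \<and>
     (\<exists>m1 m2 a11 a12 a21 a22.
        distr M (borel \<Otimes>\<^sub>M borel) (\<lambda>\<omega>. (X \<omega>, Y \<omega>)) =
        distr (std_normal_distribution \<Otimes>\<^sub>M std_normal_distribution) (borel \<Otimes>\<^sub>M borel)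
          (\<lambda>(u, v). (m1 + a11 * u + a12 * v, m2 + a21 * u + a22 * v)))"

definition covariance :: "'a measure \<Rightarrow> ('a \<Rightarrow> real) \<Rightarrow> ('a \<Rightarrow> real) \<Rightarrow> real" where
  "covariance M X Y =
     (\<integral>\<omega>. (X \<omega> - (\<integral>\<omega>'. X \<omega>' \<partial>M)) * (Y \<omega> - (\<integral>\<omega>'. Y \<omega>' \<partial>M)) \<partial>M)"

definition correlation :: "'a measure \<Rightarrow> ('a \<Rightarrow> real) \<Rightarrow> ('a \<Rightarrow> real) \<Rightarrow> real" where
  "correlation M X Y =
     covariance M X Y / sqrt (prob_space.variance M X * prob_space.variance M Y)"

definition std_bivariate_gaussian ::
    "'a measure \<Rightarrow> ('a \<Rightarrow> real) \<Rightarrow> ('a \<Rightarrow> real) \<Rightarrow> real \<Rightarrow> bool" where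
  "std_bivariate_gaussian M X Y \<rho> \<longleftrightarrow>
     gaussian_vector M X Y \<and>
     prob_space.expectation M X = 0 \<and> prob_space.expectation M Y = 0 \<and>
     prob_space.variance M X = 1 \<and> prob_space.variance M Y = 1 \<and>
     correlation M X Y = \<rho>"

definition joint_cdf ::
    "'a measure \<Rightarrow> ('a \<Rightarrow> real) \<Rightarrow> ('a \<Rightarrow> real) \<Rightarrow> real \<Rightarrow> real \<Rightarrow> real" where
  "joint_cdf M X Y s t = measure M {\<omega> \<in> space M. X \<omega> \<le> s \<and> Y \<omega> \<le> t}"

(* Independence is required within each row only; nothing is assumed about different rows. *)
definition gaussian_triangular_array ::
    "'a measure \<Rightarrow> (nat \<Rightarrow> nat \<Rightarrow> 'a \<Rightarrow> real) \<Rightarrow> (nat \<Rightarrow> nat \<Rightarrow> 'a \<Rightarrow> real) \<Rightarrow> (nat \<Rightarrow> real) \<Rightarrow> bool" where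
  "gaussian_triangular_array M X Y \<rho> \<longleftrightarrow>
     prob_space M \<and>
     (\<forall>n\<ge>1. prob_space.indep_vars M (\<lambda>_. borel \<Otimes>\<^sub>M borel) (\<lambda>k \<omega>. (X n k \<omega>, Y n k \<omega>)) {1..n}) \<and>
     (\<forall>n\<ge>1. \<forall>k\<in>{1..n}. std_bivariate_gaussian M (X n k) (Y n k) (\<rho> n))"

definition H0 :: "real \<Rightarrow> real \<Rightarrow> real" where
  "H0 s t = exp (- exp (- min s t))"

definition s_fun :: "real \<Rightarrow> real" where
  "s_fun x = ((ln x)\<^sup>2 + ln x) * inverse x"

end

theory Submission
  imports Defs "HOL-Real_Asymp.Real_Asymp"
begin

text \<open>
  Let \<open>\<phi>\<close> be the standard normal density, \<open>u\<close> the smaller of the two thresholds and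
  \<open>L = ln (min x y)\<close>, so that \<open>u = b exp (L / b\<^sup>2)\<close> with \<open>b = b\<^sub>n\<close>. The theorem separates into a
  marginal and a dependence part of \<open>\<tau>\<^sub>n = n (1 - F\<^sub>n)\<close>.

  In the marginal part, \<open>n (1 - \<Phi>(u))\<close> is the tail ratio \<open>(1 - \<Phi>(u)) / (1 - \<Phi>(b))\<close>, by the choice of
  \<open>b\<close>. Two-sided bounds on the normal tail from its asymptotic series
  (\<open>std_normal_tail_upper\<close>, \<open>std_normal_tail_lower\<close>) show that this ratio is
  \<open>exp (- L) (1 - (L\<^sup>2 + L) / b\<^sup>2 + o(1 / b\<^sup>2))\<close>; this is \<open>tail_ratio_expansion\<close>.

  In the dependence part, \<open>F\<^sub>n\<close> differs from \<open>\<Phi>(u)\<close> by at most the probability that one variable is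
  below \<open>u\<close> and the other above. Half-sum and half-difference of the pair are independent, and the
  standard deviation of the half-difference is \<open>sqrt ((1 - \<rho>) / 2)\<close>. Discordance forces the half-sum
  to within the half-difference of \<open>u\<close>, so its probability is \<open>O(sqrt (1 - \<rho>) \<phi>(u))\<close>
  (\<open>joint_cdf_near_min\<close>). Since \<open>n \<phi>(u) = O(b)\<close>, multiplication by \<open>n b\<^sup>2\<close> gives
  \<open>O(b\<^sup>3 sqrt (1 - \<rho>))\<close>, and this tends to \<open>0\<close> exactly when \<open>b\<^sup>6 (1 - \<rho>)\<close> does.

  Hence \<open>b\<^sup>2 (\<tau>\<^sub>n - exp (- L))\<close> tends to \<open>- (L\<^sup>2 + L) exp (- L)\<close>, and \<open>power_expansion\<close> carries this
  over to \<open>F\<^sub>n\<^sup>n = (1 - \<tau>\<^sub>n / n)\<^sup>n\<close>.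
\<close>

section \<open>Bounds for the normal tail\<close>

lemma std_normal_tail_nn_integral:
  "ennreal (1 - std_normal_cdf t) = (\<integral>\<^sup>+x. ennreal (std_normal_density x) * indicator {t..} x \<partial>lborel)"
proof -
  interpret real_distribution std_normal_distribution by (rule real_dist_normal_dist)
  have "1 - std_normal_cdf t = prob {t<..}"
    using prob_compl[of "{..t}"]
    by (simp add: std_normal_cdf_def cdf_def Compl_eq_Diff_UNIV[symmetric])
  then have "ennreal (1 - std_normal_cdf t) = emeasure std_normal_distribution {t<..}"
    by (simp add: emeasure_eq_measure)
  also have "\<dots> = (\<integral>\<^sup>+x. ennreal (std_normal_density x) * indicator {t<..} x \<partial>lborel)"
    by (subst emeasure_density) auto
  also have "\<dots> = (\<integral>\<^sup>+x. ennreal (std_normal_density x) * indicator {t..} x \<partial>lborel)"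
    using AE_lborel_singleton[of t]
    by (intro nn_integral_cong_AE) (auto elim!: eventually_mono split: split_indicator)
  finally show ?thesis .
qed

lemma std_normal_density_has_derivative:
  "(std_normal_density has_real_derivative - x * std_normal_density x) (at x)"
  unfolding normal_density_def by (auto intro!: derivative_eq_intros simp: field_simps)

text \<open>
  Repeated integration by parts gives the asymptotic series
  \<open>1 - \<Phi>(t) = \<phi>(t) (1/t - 1/t\<^sup>3 + 3/t\<^sup>5 - \<dots>)\<close>, whose partial sums lie alternately below and above
  the tail. Each bound is checked by differentiating: minus the derivative of \<open>\<phi>(x)\<close> times the
  partial sum differs from \<open>\<phi>(x)\<close> by one term of known sign, and everything vanishes at infinity.
\<close>

lemma std_normal_tail_upper:
  assumes t: "t > 0"
  shows "1 - std_normal_cdf t \<le> std_normal_density t * (1/t - 1/t^3 + 3/t^5)"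
proof -
  define f where "f x = std_normal_density x * (1 + 15/x^6)" for x :: real
  define G where "G x = - (std_normal_density x * (1/x - 1/x^3 + 3/x^5))" for x :: real
  have "(G has_real_derivative f x) (at x)" if "x \<ge> t" for x
    using that t unfolding f_def G_def
    by (auto intro!: derivative_eq_intros std_normal_density_has_derivative
             simp: field_simps power_numeral_reduce)
  moreover have "(G \<longlongrightarrow> 0) at_top"
    unfolding G_def normal_density_def by real_asymp
  moreover have "f \<in> borel_measurable borel" unfolding f_def by measurable
  ultimately have F: "(\<integral>\<^sup>+x. ennreal (f x) * indicator {t..} x \<partial>lborel) = 0 - G t"
    by (intro nn_integral_FTC_atLeast) (auto simp: f_def)
  have "ennreal (1 - std_normal_cdf t) \<le> (\<integral>\<^sup>+x. ennreal (f x) * indicator {t..} x \<partial>lborel)"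
    unfolding std_normal_tail_nn_integral
    by (intro nn_integral_mono)
      (auto simp: f_def mult_le_cancel_left1 not_less[THEN iffD2] split: split_indicator intro!: ennreal_leI)
  also note F
  finally have "ennreal (1 - std_normal_cdf t) \<le> ennreal (- G t)" by simp
  moreover have "0 \<le> - G t"
  proof -
    have "1/t - 1/t^3 + 3/t^5 = ((t^2 - 1/2)^2 + 11/4) / t^5"
      using t by (simp add: field_simps power_numeral_reduce)
    also have "\<dots> \<ge> 0" using t by (auto intro!: divide_nonneg_pos add_nonneg_nonneg)
    finally show ?thesis by (simp add: G_def)
  qed
  ultimately show ?thesis by (simp add: G_def)
qed

text \<open>
  The same argument one term earlier, where the derivative is \<open>\<phi>(x) (1 - 3/x\<^sup>4)\<close> up to sign. The
  assumption \<open>t \<ge> 2\<close> keeps this integrand nonnegative, so that it can be integrated as an extended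
  nonnegative function.
\<close>

lemma std_normal_tail_lower:
  assumes t: "t \<ge> 2"
  shows "std_normal_density t * (1/t - 1/t^3) \<le> 1 - std_normal_cdf t"
proof -
  define f where "f x = std_normal_density x * (1 - 3/x^4)" for x :: real
  define G where "G x = - (std_normal_density x * (1/x - 1/x^3))" for x :: real
  have deriv: "(G has_real_derivative f x) (at x)" if "x \<ge> t" for x
    using that t unfolding f_def G_def
    by (auto intro!: derivative_eq_intros std_normal_density_has_derivative
             simp: field_simps power_numeral_reduce)
  have lim: "(G \<longlongrightarrow> 0) at_top"
    unfolding G_def normal_density_def by real_asymp
  have meas: "f \<in> borel_measurable borel" unfolding f_def by measurable
  have nonneg: "f x \<ge> 0" if "x \<ge> t" for x
  proof -
    have "(2::real)^4 \<le> x^4" using that t by (intro power_mono) auto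
    then have "3 / x^4 \<le> 1" by (simp add: divide_le_eq)
    then show ?thesis by (simp add: f_def)
  qed
  have F: "(\<integral>\<^sup>+x. ennreal (f x) * indicator {t..} x \<partial>lborel) = 0 - G t"
    by (intro nn_integral_FTC_atLeast deriv lim meas nonneg)
  have "(\<integral>\<^sup>+x. ennreal (f x) * indicator {t..} x \<partial>lborel) \<le> ennreal (1 - std_normal_cdf t)"
    unfolding std_normal_tail_nn_integral
    by (intro nn_integral_mono) (auto simp: f_def mult_le_cancel_left2 not_less[THEN iffD2] split: split_indicator intro!: ennreal_leI)
  then have "ennreal (- G t) \<le> ennreal (1 - std_normal_cdf t)" using F by simp
  moreover have "0 \<le> 1 - std_normal_cdf t"
    using real_distribution.cdf_bounded_prob[OF real_dist_normal_dist] by (simp add: std_normal_cdf_def)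
  ultimately show ?thesis by (simp add: G_def)
qed
section \<open>The law of a standard bivariate Gaussian pair\<close>

abbreviation std_normal_pair :: "(real \<times> real) measure" where
  "std_normal_pair \<equiv> std_normal_distribution \<Otimes>\<^sub>M std_normal_distribution"

definition rotation :: "real \<Rightarrow> real \<times> real \<Rightarrow> real \<times> real" where
  "rotation \<theta> = (\<lambda>(u, v). (cos \<theta> * u + sin \<theta> * v, cos \<theta> * v - sin \<theta> * u))"

lemma measurable_rotation [measurable]: "rotation \<theta> \<in> borel \<Otimes>\<^sub>M borel \<rightarrow>\<^sub>M borel \<Otimes>\<^sub>M borel"
  unfolding rotation_def by measurable

text \<open>
  A rotation with \<open>cos \<theta> \<noteq> 0\<close> factors into two substitutions, each changing one coordinate by an
  affine map while the other is held fixed; the Jacobians \<open>1 / cos \<theta>\<close> and \<open>cos \<theta>\<close> cancel. If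
  \<open>cos \<theta> = 0\<close>, the rotation is an exchange of coordinates combined with a reflection.
\<close>

lemma nn_integral_lborel_rotation:
  fixes f :: "real \<times> real \<Rightarrow> ennreal"
  assumes [measurable]: "f \<in> borel_measurable (borel \<Otimes>\<^sub>M borel)"
  shows "(\<integral>\<^sup>+u. \<integral>\<^sup>+v. f (rotation \<theta> (u, v)) \<partial>lborel \<partial>lborel) = (\<integral>\<^sup>+u. \<integral>\<^sup>+v. f (u, v) \<partial>lborel \<partial>lborel)"
proof (cases "cos \<theta> = 0")
  case True
  then have s: "sin \<theta> \<noteq> 0" "\<bar>sin \<theta>\<bar> = 1"
    using sin_cos_squared_add[of \<theta>] by (auto simp: power2_eq_1_iff)
  have "(\<integral>\<^sup>+u. \<integral>\<^sup>+v. f (rotation \<theta> (u, v)) \<partial>lborel \<partial>lborel) =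
      (\<integral>\<^sup>+u. \<integral>\<^sup>+v. f (0 + sin \<theta> * v, - sin \<theta> * u) \<partial>lborel \<partial>lborel)"
    using True by (simp add: rotation_def)
  also have "\<dots> = (\<integral>\<^sup>+u. \<integral>\<^sup>+v. f (v, - sin \<theta> * u) \<partial>lborel \<partial>lborel)"
    proof (rule nn_integral_cong)
    fix u
    show "(\<integral>\<^sup>+v. f (0 + sin \<theta> * v, - sin \<theta> * u) \<partial>lborel) = (\<integral>\<^sup>+v. f (v, - sin \<theta> * u) \<partial>lborel)"
      using nn_integral_real_affine[of "\<lambda>x. f (x, - sin \<theta> * u)", OF _ s(1), of 0] by (simp add: s)
  qed
  also have "\<dots> = (\<integral>\<^sup>+u. \<integral>\<^sup>+v. f (v, u) \<partial>lborel \<partial>lborel)"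
    using nn_integral_real_affine[of "\<lambda>x. \<integral>\<^sup>+v. f (v, x) \<partial>lborel" "- sin \<theta>" 0] s by simp
  also have "\<dots> = (\<integral>\<^sup>+u. \<integral>\<^sup>+v. f (u, v) \<partial>lborel \<partial>lborel)"
    by (rule lborel_pair.Fubini') simp
  finally show ?thesis .
next
  case False
  define c s where "c = cos \<theta>" and "s = sin \<theta>"
  have c: "c \<noteq> 0" and cs: "c * c + s * s = 1"
    using False sin_cos_squared_add[of \<theta>] by (auto simp: c_def s_def power2_eq_square)
  have "(\<integral>\<^sup>+u. \<integral>\<^sup>+v. f (rotation \<theta> (u, v)) \<partial>lborel \<partial>lborel) =
      (\<integral>\<^sup>+v. \<integral>\<^sup>+u. f (c * u + s * v, c * v - s * u) \<partial>lborel \<partial>lborel)"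
    unfolding rotation_def c_def s_def prod.case by (rule lborel_pair.Fubini'[symmetric]) simp
  also have "\<dots> = (\<integral>\<^sup>+v. ennreal \<bar>1 / c\<bar> * (\<integral>\<^sup>+p. f (p, (v - s * p) / c) \<partial>lborel) \<partial>lborel)"
  proof (rule nn_integral_cong)
    fix v
    have *: "c * v - s * (- s * v / c + 1 / c * p) = (v - s * p) / c" for p
    proof -
      have "c * v - s * (- s * v / c + 1 / c * p) = ((c * c + s * s) * v - s * p) / c"
        using c by (simp add: field_simps)
      then show ?thesis by (simp add: cs)
    qed
    have **: "c * (- s * v / c + 1 / c * p) + s * v = p" for p
      using c by (simp add: field_simps)
    show "(\<integral>\<^sup>+u. f (c * u + s * v, c * v - s * u) \<partial>lborel) =
        ennreal \<bar>1 / c\<bar> * (\<integral>\<^sup>+p. f (p, (v - s * p) / c) \<partial>lborel)"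
      using c by (subst nn_integral_real_affine[where t="- s * v / c" and c="1 / c"]) (simp_all only: * **, auto)
  qed
  also have "\<dots> = ennreal \<bar>1 / c\<bar> * (\<integral>\<^sup>+v. \<integral>\<^sup>+p. f (p, (v - s * p) / c) \<partial>lborel \<partial>lborel)"
    by (rule nn_integral_cmult) simp
  also have "(\<integral>\<^sup>+v. \<integral>\<^sup>+p. f (p, (v - s * p) / c) \<partial>lborel \<partial>lborel) =
      (\<integral>\<^sup>+p. \<integral>\<^sup>+v. f (p, (v - s * p) / c) \<partial>lborel \<partial>lborel)"
    by (rule lborel_pair.Fubini') simp
  also have "\<dots> = (\<integral>\<^sup>+p. ennreal \<bar>c\<bar> * (\<integral>\<^sup>+q. f (p, q) \<partial>lborel) \<partial>lborel)"
  proof (rule nn_integral_cong)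
    fix p
    show "(\<integral>\<^sup>+v. f (p, (v - s * p) / c) \<partial>lborel) = ennreal \<bar>c\<bar> * (\<integral>\<^sup>+q. f (p, q) \<partial>lborel)"
      using c by (subst nn_integral_real_affine[where t="s * p" and c=c]) auto
  qed
  also have "\<dots> = ennreal \<bar>c\<bar> * (\<integral>\<^sup>+p. \<integral>\<^sup>+q. f (p, q) \<partial>lborel \<partial>lborel)"
    by (rule nn_integral_cmult) simp
  also have "ennreal \<bar>1 / c\<bar> * (ennreal \<bar>c\<bar> * (\<integral>\<^sup>+p. \<integral>\<^sup>+q. f (p, q) \<partial>lborel \<partial>lborel)) =
      (\<integral>\<^sup>+p. \<integral>\<^sup>+q. f (p, q) \<partial>lborel \<partial>lborel)"
    using c by (simp add: mult.assoc[symmetric] ennreal_mult[symmetric])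
  finally show ?thesis .
qed

interpretation std_normal: real_distribution std_normal_distribution
  by (rule real_dist_normal_dist)

interpretation std_normal_pair: pair_prob_space std_normal_distribution std_normal_distribution ..

lemma nn_integral_std_normal_pair:
  fixes f :: "real \<times> real \<Rightarrow> ennreal"
  assumes [measurable]: "f \<in> borel_measurable (borel \<Otimes>\<^sub>M borel)"
  shows "(\<integral>\<^sup>+z. f z \<partial>std_normal_pair) =
    (\<integral>\<^sup>+u. \<integral>\<^sup>+v. ennreal (std_normal_density u * std_normal_density v) * f (u, v) \<partial>lborel \<partial>lborel)"
proof -
  have "f \<in> borel_measurable (std_normal_distribution \<Otimes>\<^sub>M std_normal_distribution)" by measurable
  then have "(\<integral>\<^sup>+z. f z \<partial>std_normal_pair) = (\<integral>\<^sup>+u. \<integral>\<^sup>+v. f (u, v) \<partial>std_normal_distribution \<partial>std_normal_distribution)"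
    by (rule std_normal.nn_integral_fst[symmetric])
  also have "\<dots> = (\<integral>\<^sup>+u. ennreal (std_normal_density u) * (\<integral>\<^sup>+v. ennreal (std_normal_density v) * f (u, v) \<partial>lborel) \<partial>lborel)"
    by (simp add: nn_integral_density)
  also have "\<dots> = (\<integral>\<^sup>+u. \<integral>\<^sup>+v. ennreal (std_normal_density u * std_normal_density v) * f (u, v) \<partial>lborel \<partial>lborel)"
    by (simp add: nn_integral_cmult[symmetric] ennreal_mult mult.assoc)
  finally show ?thesis .
qed

text \<open>
  The joint density depends on \<open>u\<^sup>2 + v\<^sup>2\<close> only.
\<close>

lemma distr_std_normal_pair_rotation:
  "distr std_normal_pair (borel \<Otimes>\<^sub>M borel) (rotation \<theta>) = std_normal_pair"
proof (rule measure_eqI)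
  show "sets (distr std_normal_pair (borel \<Otimes>\<^sub>M borel) (rotation \<theta>)) = sets std_normal_pair"
    by (simp cong: sets_pair_measure_cong)
next
  fix A assume "A \<in> sets (distr std_normal_pair (borel \<Otimes>\<^sub>M borel) (rotation \<theta>))"
  then have A [measurable]: "A \<in> sets (borel \<Otimes>\<^sub>M borel)" by simp
  define g where "g z = ennreal (std_normal_density (fst z) * std_normal_density (snd z)) * indicator A z" for z
  have [measurable]: "g \<in> borel_measurable (borel \<Otimes>\<^sub>M borel)" unfolding g_def by measurable
  have eq: "std_normal_density (fst (rotation \<theta> (u, v))) * std_normal_density (snd (rotation \<theta> (u, v))) =
      std_normal_density u * std_normal_density v" for u v
  proof -
    have "(cos \<theta> * u + sin \<theta> * v)\<^sup>2 + (cos \<theta> * v - sin \<theta> * u)\<^sup>2 = ((sin \<theta>)\<^sup>2 + (cos \<theta>)\<^sup>2) * (u\<^sup>2 + v\<^sup>2)"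
      by algebra
    then have "(cos \<theta> * u + sin \<theta> * v)\<^sup>2 + (cos \<theta> * v - sin \<theta> * u)\<^sup>2 = u\<^sup>2 + v\<^sup>2" by simp
    then show ?thesis
      by (simp add: rotation_def std_normal_density_def mult_exp_exp add_divide_distrib[symmetric])
  qed
  have "emeasure (distr std_normal_pair (borel \<Otimes>\<^sub>M borel) (rotation \<theta>)) A = (\<integral>\<^sup>+z. indicator A z \<partial>distr std_normal_pair (borel \<Otimes>\<^sub>M borel) (rotation \<theta>))"
    by (rule nn_integral_indicator[symmetric]) simp
  also have "\<dots> = (\<integral>\<^sup>+z. indicator A (rotation \<theta> z) \<partial>std_normal_pair)"
    by (rule nn_integral_distr) auto
  also have "\<dots> = (\<integral>\<^sup>+u. \<integral>\<^sup>+v. g (rotation \<theta> (u, v)) \<partial>lborel \<partial>lborel)"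
    by (simp add: nn_integral_std_normal_pair g_def eq)
  also have "\<dots> = (\<integral>\<^sup>+u. \<integral>\<^sup>+v. g (u, v) \<partial>lborel \<partial>lborel)"
    by (rule nn_integral_lborel_rotation) simp
  also have "\<dots> = (\<integral>\<^sup>+z. indicator A z \<partial>std_normal_pair)"
    by (subst nn_integral_std_normal_pair) (simp_all add: g_def)
  also have "\<dots> = emeasure std_normal_pair A"
    by (rule nn_integral_indicator) (simp cong: sets_pair_measure_cong)
  finally show "emeasure (distr std_normal_pair (borel \<Otimes>\<^sub>M borel) (rotation \<theta>)) A = emeasure std_normal_pair A" .
qed

text \<open>
  These moments turn the prescribed means, variances and correlation of a Gaussian vector into
  equations for the coefficients of its affine representation.
\<close>

lemma std_normal_pair_moments:
  shows "has_bochner_integral std_normal_pair (\<lambda>z. fst z) 0"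
    and "has_bochner_integral std_normal_pair (\<lambda>z. snd z) 0"
    and "has_bochner_integral std_normal_pair (\<lambda>z. (fst z)\<^sup>2) 1"
    and "has_bochner_integral std_normal_pair (\<lambda>z. (snd z)\<^sup>2) 1"
    and "has_bochner_integral std_normal_pair (\<lambda>z. fst z * snd z) 0"
proof -
  have m1: "has_bochner_integral std_normal_distribution (\<lambda>x. x) 0"
    using integrable_std_normal_distribution_moment[of 1] integral_std_normal_distribution_moment_odd[of 1]
    by (simp add: has_bochner_integral_iff)
  have m2: "has_bochner_integral std_normal_distribution (\<lambda>x. x\<^sup>2) 1"
    using integrable_std_normal_distribution_moment[of 2] std_normal_distribution_even_moments(1)[of 1]
    by (simp add: has_bochner_integral_iff)
  have fst: "has_bochner_integral std_normal_pair (\<lambda>z. f (fst z)) c"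
    if "has_bochner_integral std_normal_distribution f c" for f :: "real \<Rightarrow> real" and c
  proof -
    have [measurable]: "f \<in> borel_measurable borel"
      using that by (auto simp: has_bochner_integral_iff)
    have "distr std_normal_pair std_normal_distribution fst = std_normal_distribution"
      by (rule std_normal.distr_pair_fst)
    then have "has_bochner_integral (distr std_normal_pair std_normal_distribution fst) f c"
      using that by simp
    then show ?thesis
      by (simp add: has_bochner_integral_iff integrable_distr_eq integral_distr)
  qed
  have swap: "has_bochner_integral std_normal_pair (\<lambda>z. f (snd z)) c"
    if "has_bochner_integral std_normal_pair (\<lambda>z. f (fst z)) c" for f :: "real \<Rightarrow> real" and c
  proof -
    have [measurable]: "(\<lambda>z. f (fst z)) \<in> borel_measurable (std_normal_pair)"
      using that by (auto simp: has_bochner_integral_iff)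
    show ?thesis
      using that std_normal_pair.integrable_product_swap[of "\<lambda>z. f (fst z)"]
        std_normal_pair.integral_product_swap[of "\<lambda>z. f (fst z)"]
      by (simp add: has_bochner_integral_iff split_beta')
  qed
  show 1: "has_bochner_integral std_normal_pair (\<lambda>z. fst z) 0" by (rule fst[OF m1])
  show 2: "has_bochner_integral std_normal_pair (\<lambda>z. snd z) 0" by (rule swap[OF fst[OF m1]])
  show 3: "has_bochner_integral std_normal_pair (\<lambda>z. (fst z)\<^sup>2) 1" by (rule fst[OF m2])
  show 4: "has_bochner_integral std_normal_pair (\<lambda>z. (snd z)\<^sup>2) 1" by (rule swap[OF fst[OF m2]])
  have int: "integrable std_normal_pair (\<lambda>z. fst z * snd z)"
  proof (rule Bochner_Integration.integrable_bound)
    show "integrable std_normal_pair (\<lambda>z. (fst z)\<^sup>2 + (snd z)\<^sup>2)"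
      using 3 4 by (simp add: has_bochner_integral_iff)
    show "AE z in std_normal_pair. norm (fst z * snd z) \<le> norm ((fst z)\<^sup>2 + (snd z)\<^sup>2)"
    proof (rule AE_I2)
      fix z :: "real \<times> real"
      have "2 * (\<bar>fst z\<bar> * \<bar>snd z\<bar>) \<le> (fst z)\<^sup>2 + (snd z)\<^sup>2"
        using sum_squares_bound[of "\<bar>fst z\<bar>" "\<bar>snd z\<bar>"] by simp
      moreover have "0 \<le> \<bar>fst z\<bar> * \<bar>snd z\<bar>" by simp
      ultimately show "norm (fst z * snd z) \<le> norm ((fst z)\<^sup>2 + (snd z)\<^sup>2)"
        unfolding real_norm_def abs_mult by linarith
    qed
  qed simp
  have "(\<integral>z. fst z * snd z \<partial>std_normal_pair) = (\<integral>u. \<integral>v. u * v \<partial>std_normal_distribution \<partial>std_normal_distribution)"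
    using std_normal_pair.integral_fst'[OF int] by simp
  also have "\<dots> = 0" using m1 by (simp add: has_bochner_integral_iff)
  finally show "has_bochner_integral std_normal_pair (\<lambda>z. fst z * snd z) 0"
    using int by (simp add: has_bochner_integral_iff)
qed

lemma integral_linear_product:
  "(\<integral>z. (a * fst z + b * snd z) * (c * fst z + d * snd z) \<partial>std_normal_pair) = a * c + b * d"
proof -
  have eq: "(a * fst z + b * snd z) * (c * fst z + d * snd z) =
      (a * c) * (fst z)\<^sup>2 + (b * d) * (snd z)\<^sup>2 + (a * d + b * c) * (fst z * snd z)" for z :: "real \<times> real"
    by algebra
  have "has_bochner_integral std_normal_pair
      (\<lambda>z. (a * c) * (fst z)\<^sup>2 + (b * d) * (snd z)\<^sup>2 + (a * d + b * c) * (fst z * snd z))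
      ((a * c) * 1 + (b * d) * 1 + (a * d + b * c) * 0)"
    by (intro has_bochner_integral_add has_bochner_integral_mult_right std_normal_pair_moments)
  then show ?thesis unfolding eq by (simp add: has_bochner_integral_iff)
qed

lemma integral_affine:
  "(\<integral>z. m + a * fst z + b * snd z \<partial>std_normal_pair) = m"
proof -
  have "has_bochner_integral std_normal_pair (\<lambda>z. m + a * fst z + b * snd z) (m + a * 0 + b * 0)"
    by (intro has_bochner_integral_add has_bochner_integral_mult_right std_normal_pair_moments)
      (simp add: has_bochner_integral_iff std_normal_pair.prob_space)
  then show ?thesis by (simp add: has_bochner_integral_iff)
qed

text \<open>
  The unit variances say that both rows of the coefficient matrix are unit vectors, hence given by
  angles \<open>\<alpha>\<close> and \<open>\<beta>\<close>; the correlation is their inner product \<open>cos (\<alpha> - \<beta>)\<close>. This description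
  is uniform in \<open>\<rho>\<close> and includes the degenerate case \<open>\<rho> = 1\<close>.
\<close>

lemma std_bivariate_gaussian_angles:
  assumes "prob_space M" and G: "std_bivariate_gaussian M X Y \<rho>"
  obtains \<alpha> \<beta> where "cos (\<alpha> - \<beta>) = \<rho>"
    and "\<And>s t. joint_cdf M X Y s t =
      measure std_normal_pair {z. fst (rotation \<alpha> z) \<le> s \<and> fst (rotation \<beta> z) \<le> t}"
proof -
  interpret prob_space M by fact
  from G have XY [measurable]: "X \<in> borel_measurable M" "Y \<in> borel_measurable M"
    and EX: "expectation X = 0" "expectation Y = 0"
    and VX: "variance X = 1" "variance Y = 1" and C: "correlation M X Y = \<rho>"
    by (auto simp: std_bivariate_gaussian_def gaussian_vector_def)
  from G obtain m1 m2 a11 a12 a21 a22 where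
    law: "distr M (borel \<Otimes>\<^sub>M borel) (\<lambda>\<omega>. (X \<omega>, Y \<omega>)) =
        distr std_normal_pair (borel \<Otimes>\<^sub>M borel)
          (\<lambda>(u, v). (m1 + a11 * u + a12 * v, m2 + a21 * u + a22 * v))"
    unfolding std_bivariate_gaussian_def gaussian_vector_def by blast
  have transfer: "(\<integral>\<omega>. h (X \<omega>, Y \<omega>) \<partial>M) =
      (\<integral>z. h (m1 + a11 * fst z + a12 * snd z, m2 + a21 * fst z + a22 * snd z) \<partial>std_normal_pair)"
    if [measurable]: "h \<in> borel_measurable (borel \<Otimes>\<^sub>M borel)" for h :: "real \<times> real \<Rightarrow> real"
  proof -
    have "(\<integral>\<omega>. h (X \<omega>, Y \<omega>) \<partial>M) = integral\<^sup>L (distr M (borel \<Otimes>\<^sub>M borel) (\<lambda>\<omega>. (X \<omega>, Y \<omega>))) h"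
      by (subst integral_distr) auto
    also have "\<dots> = (\<integral>z. h (m1 + a11 * fst z + a12 * snd z, m2 + a21 * fst z + a22 * snd z) \<partial>std_normal_pair)"
      unfolding law by (subst integral_distr) (auto simp: split_beta')
    finally show ?thesis .
  qed
  have m: "m1 = 0" "m2 = 0"
    using EX transfer[of fst] transfer[of snd] by (simp_all add: integral_affine)
  have "a11 * a11 + a12 * a12 = 1"
    using VX(1) transfer[of "\<lambda>z. fst z * fst z"]
    by (simp add: EX m integral_linear_product power2_eq_square)
  then obtain \<alpha> where \<alpha>: "a11 = cos \<alpha>" "a12 = sin \<alpha>"
    using sincos_total_2pi[of a11 a12] by (auto simp: power2_eq_square)
  have "a21 * a21 + a22 * a22 = 1"
    using VX(2) transfer[of "\<lambda>z. snd z * snd z"]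
    by (simp add: EX m integral_linear_product power2_eq_square)
  then obtain \<beta> where \<beta>: "a21 = cos \<beta>" "a22 = sin \<beta>"
    using sincos_total_2pi[of a21 a22] by (auto simp: power2_eq_square)
  have "a11 * a21 + a12 * a22 = \<rho>"
    using C VX transfer[of "\<lambda>z. fst z * snd z"]
    by (simp add: correlation_def covariance_def EX m integral_linear_product)
  then have "cos (\<alpha> - \<beta>) = \<rho>" by (simp add: \<alpha> \<beta> cos_diff)
  moreover have "joint_cdf M X Y s t =
      measure std_normal_pair {z. fst (rotation \<alpha> z) \<le> s \<and> fst (rotation \<beta> z) \<le> t}" for s t
  proof -
    have "joint_cdf M X Y s t = measure (distr M (borel \<Otimes>\<^sub>M borel) (\<lambda>\<omega>. (X \<omega>, Y \<omega>))) ({..s} \<times> {..t})"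
      unfolding joint_cdf_def by (subst measure_distr) (auto intro!: arg_cong[where f="measure M"])
    also have "\<dots> = measure std_normal_pair {z. fst (rotation \<alpha> z) \<le> s \<and> fst (rotation \<beta> z) \<le> t}"
      unfolding law by (subst measure_distr)
        (auto simp: m \<alpha> \<beta> rotation_def space_pair_measure split_beta' intro!: arg_cong[where f="measure std_normal_pair"])
    finally show ?thesis .
  qed
  ultimately show thesis by (rule that)
qed

lemma sets_std_normal_pair_Collect:
  assumes [measurable]: "Measurable.pred (borel \<Otimes>\<^sub>M borel) P"
  shows "{z. P z} \<in> sets std_normal_pair"
proof -
  have "{z \<in> space (borel \<Otimes>\<^sub>M borel). P z} \<in> sets (borel \<Otimes>\<^sub>M borel)" by measurable
  then show ?thesis by (simp add: space_pair_measure cong: sets_pair_measure_cong)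
qed

lemma measure_rotation:
  assumes [measurable]: "Measurable.pred (borel \<Otimes>\<^sub>M borel) P"
  shows "measure std_normal_pair {z. P (rotation \<theta> z)} = measure std_normal_pair {z. P z}"
proof -
  have [measurable]: "{z. P z} \<in> sets (borel \<Otimes>\<^sub>M borel)"
    using sets_std_normal_pair_Collect[OF assms] by (simp cong: sets_pair_measure_cong)
  have "measure std_normal_pair {z. P z} = measure (distr std_normal_pair (borel \<Otimes>\<^sub>M borel) (rotation \<theta>)) {z. P z}"
    by (simp only: distr_std_normal_pair_rotation)
  also have "\<dots> = measure std_normal_pair {z. P (rotation \<theta> z)}"
    by (subst measure_distr) (auto simp: space_pair_measure vimage_def)
  finally show ?thesis by simp
qed

lemma measure_rotation_fst_le: "measure std_normal_pair {z. fst (rotation \<theta> z) \<le> s} = std_normal_cdf s"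
proof -
  have "measure std_normal_pair {z. fst (rotation \<theta> z) \<le> s} = measure std_normal_pair {z. fst z \<le> s}"
    by (rule measure_rotation) simp
  also have "\<dots> = measure (distr std_normal_pair std_normal_distribution fst) {..s}"
    by (subst measure_distr) (auto simp: space_pair_measure intro!: arg_cong[where f="measure std_normal_pair"])
  also have "\<dots> = std_normal_cdf s"
    by (simp only: std_normal.distr_pair_fst std_normal_cdf_def cdf_def)
  finally show ?thesis .
qed

text \<open>
  For fixed \<open>q\<close> the event confines \<open>p\<close> to an interval of length \<open>2 |\<delta> q| / |\<sigma>|\<close> around
  \<open>u / \<sigma>\<close>, on which \<open>(\<sigma> p - u)\<^sup>2 \<ge> 0\<close> yields \<open>p\<^sup>2 \<ge> (\<sigma> p)\<^sup>2 \<ge> u\<^sup>2 - 2 u |\<delta> q|\<close>, and as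
  \<open>u |\<delta>| \<le> 1\<close>, the density there exceeds \<open>\<phi>(u)\<close> at most by the factor \<open>exp |q|\<close>. Integrating over \<open>q\<close> costs only a constant. The
  factor \<open>\<phi>(u)\<close> is essential: it puts the bound on the scale of the tail at \<open>u\<close>.
\<close>

lemma strip_probability:
  fixes \<sigma> \<delta> u :: real
  assumes \<sigma>: "\<sigma> \<noteq> 0" and \<sigma>1: "\<bar>\<sigma>\<bar> \<le> 1" and u: "0 \<le> u" and u\<delta>: "u * \<bar>\<delta>\<bar> \<le> 1"
  shows "measure std_normal_pair {z. \<sigma> * fst z - \<delta> * snd z \<le> u \<and> u < \<sigma> * fst z + \<delta> * snd z}
    \<le> 2 * sqrt 2 * exp 4 * (\<bar>\<delta>\<bar> / \<bar>\<sigma>\<bar>) * std_normal_density u"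
proof -
  define A where "A = {z. \<sigma> * fst z - \<delta> * snd z \<le> u \<and> u < \<sigma> * fst z + \<delta> * snd z}"
  have A [measurable]: "A \<in> sets (borel \<Otimes>\<^sub>M borel)"
    using sets_std_normal_pair_Collect[of "\<lambda>z. \<sigma> * fst z - \<delta> * snd z \<le> u \<and> u < \<sigma> * fst z + \<delta> * snd z"]
    by (simp add: A_def cong: sets_pair_measure_cong)
  define I where "I q = {u / \<sigma> - \<bar>\<delta> * q\<bar> / \<bar>\<sigma>\<bar> .. u / \<sigma> + \<bar>\<delta> * q\<bar> / \<bar>\<sigma>\<bar>}" for q
  have inner: "ennreal (std_normal_density p * std_normal_density q) * indicator A (p, q) \<le>
      ennreal (std_normal_density q * (std_normal_density u * exp \<bar>q\<bar>)) * indicator (I q) p" for p q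
  proof (cases "(p, q) \<in> A")
    case True
    define d where "d = \<bar>\<delta> * q\<bar>"
    from True have close: "\<bar>\<sigma> * p - u\<bar> \<le> d" by (auto simp: A_def d_def)
    then have "\<bar>\<sigma> * p - u\<bar> / \<bar>\<sigma>\<bar> \<le> d / \<bar>\<sigma>\<bar>" using \<sigma> by (intro divide_right_mono) auto
    moreover have "\<sigma> * p - u = \<sigma> * (p - u / \<sigma>)" using \<sigma> by (simp add: right_diff_distrib)
    then have "\<bar>\<sigma> * p - u\<bar> / \<bar>\<sigma>\<bar> = \<bar>p - u / \<sigma>\<bar>" using \<sigma> by (simp add: abs_mult)
    ultimately have "p \<in> I q" by (auto simp: I_def d_def)
    have "2 * (u * \<sigma> * p) - u\<^sup>2 \<le> (\<sigma> * p)\<^sup>2"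
      using zero_le_power2[of "\<sigma> * p - u"] by (simp add: power2_eq_square algebra_simps)
    moreover have "u * (u - \<sigma> * p) \<le> u * d" using close u by (intro mult_left_mono) auto
    moreover have "(\<sigma> * p)\<^sup>2 \<le> p\<^sup>2"
    proof -
      have "\<sigma>\<^sup>2 * p\<^sup>2 \<le> 1 * p\<^sup>2" using \<sigma>1 by (intro mult_right_mono) (auto simp: abs_square_le_1)
      then show ?thesis by (simp add: power_mult_distrib)
    qed
    ultimately have "u\<^sup>2 - 2 * (u * d) \<le> p\<^sup>2" by (simp add: power2_eq_square algebra_simps)
    moreover have "u * d \<le> \<bar>q\<bar>"
      using mult_right_mono[OF u\<delta>, of "\<bar>q\<bar>"] by (simp add: d_def abs_mult mult.assoc)
    ultimately have "- p\<^sup>2 / 2 \<le> - u\<^sup>2 / 2 + \<bar>q\<bar>" by simp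
    then have "exp (- p\<^sup>2 / 2) \<le> exp (- u\<^sup>2 / 2) * exp \<bar>q\<bar>" by (simp add: exp_add[symmetric])
    then have "std_normal_density p \<le> std_normal_density u * exp \<bar>q\<bar>"
      unfolding std_normal_density_def mult.assoc by (intro mult_left_mono) auto
    then have "std_normal_density p * std_normal_density q \<le> std_normal_density q * (std_normal_density u * exp \<bar>q\<bar>)"
      by (subst mult.commute) (rule mult_left_mono, auto)
    then show ?thesis using True \<open>p \<in> I q\<close> by (simp add: ennreal_leI)
  qed simp
  define K where "K = 2 * (\<bar>\<delta>\<bar> / \<bar>\<sigma>\<bar>) * std_normal_density u"
  have K: "K \<ge> 0" by (simp add: K_def)
  have "emeasure std_normal_pair A = (\<integral>\<^sup>+z. indicator A z \<partial>std_normal_pair)"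
    by (rule nn_integral_indicator[symmetric]) (simp cong: sets_pair_measure_cong)
  also have "\<dots> = (\<integral>\<^sup>+p. \<integral>\<^sup>+q. ennreal (std_normal_density p * std_normal_density q) * indicator A (p, q) \<partial>lborel \<partial>lborel)"
    by (subst nn_integral_std_normal_pair) simp_all
  also have "\<dots> = (\<integral>\<^sup>+q. \<integral>\<^sup>+p. ennreal (std_normal_density p * std_normal_density q) * indicator A (p, q) \<partial>lborel \<partial>lborel)"
    by (rule lborel_pair.Fubini'[symmetric]) simp
  also have "\<dots> \<le> (\<integral>\<^sup>+q. ennreal (std_normal_density q * (std_normal_density u * exp \<bar>q\<bar>)) * emeasure lborel (I q) \<partial>lborel)"
  proof (rule nn_integral_mono)
    fix q :: real
    have "(\<integral>\<^sup>+p. ennreal (std_normal_density p * std_normal_density q) * indicator A (p, q) \<partial>lborel) \<le>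
      (\<integral>\<^sup>+p. ennreal (std_normal_density q * (std_normal_density u * exp \<bar>q\<bar>)) * indicator (I q) p \<partial>lborel)"
      by (intro nn_integral_mono inner)
    also have "\<dots> = ennreal (std_normal_density q * (std_normal_density u * exp \<bar>q\<bar>)) * emeasure lborel (I q)"
      by (rule nn_integral_cmult_indicator) (simp add: I_def)
    finally show "(\<integral>\<^sup>+p. ennreal (std_normal_density p * std_normal_density q) * indicator A (p, q) \<partial>lborel) \<le>
      ennreal (std_normal_density q * (std_normal_density u * exp \<bar>q\<bar>)) * emeasure lborel (I q)" .
  qed
  also have "\<dots> \<le> (\<integral>\<^sup>+q. ennreal (K * (exp 4 * sqrt 2)) * ennreal (normal_density 0 (sqrt 2) q) \<partial>lborel)"
  proof (rule nn_integral_mono)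
    fix q :: real
    \<comment> \<open>By \<open>2 |q| \<le> 4 + q\<^sup>2 / 4\<close>, the weight \<open>|q| exp |q|\<close> is absorbed by doubling the variance.\<close>
    have "\<bar>q\<bar> \<le> exp \<bar>q\<bar>" using exp_ge_add_one_self[of "\<bar>q\<bar>"] by linarith
    then have "exp \<bar>q\<bar> * \<bar>q\<bar> \<le> exp \<bar>q\<bar> * exp \<bar>q\<bar>" by (intro mult_left_mono) auto
    also have "\<dots> = exp (2 * \<bar>q\<bar>)" by (simp add: exp_add[symmetric])
    finally have "std_normal_density q * (exp \<bar>q\<bar> * \<bar>q\<bar>) \<le> std_normal_density q * exp (2 * \<bar>q\<bar>)"
      by (rule mult_left_mono) simp
    also have "\<dots> = (1 / sqrt (2 * pi)) * exp (2 * \<bar>q\<bar> - q\<^sup>2 / 2)"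
      by (simp add: std_normal_density_def exp_add[symmetric])
    also have "\<dots> \<le> (1 / sqrt (2 * pi)) * exp (4 + - q\<^sup>2 / 4)"
      using zero_le_power2[of "\<bar>q\<bar> / 2 - 2"]
      by (intro mult_left_mono) (auto simp: power2_diff power_divide)
    also have "\<dots> = exp 4 * sqrt 2 * normal_density 0 (sqrt 2) q"
      by (simp only: exp_add) (simp add: normal_density_def real_sqrt_mult field_simps)
    finally have "std_normal_density q * (exp \<bar>q\<bar> * \<bar>q\<bar>) \<le> exp 4 * sqrt 2 * normal_density 0 (sqrt 2) q" .
    from mult_left_mono[OF this K]
    have le: "K * (std_normal_density q * (exp \<bar>q\<bar> * \<bar>q\<bar>)) \<le> K * (exp 4 * sqrt 2) * normal_density 0 (sqrt 2) q"
      by (simp add: mult.assoc)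
    have "emeasure lborel (I q) = ennreal (2 * (\<bar>\<delta>\<bar> * \<bar>q\<bar> / \<bar>\<sigma>\<bar>))"
      unfolding I_def by (subst emeasure_lborel_Icc) (auto simp: abs_mult)
    then have "ennreal (std_normal_density q * (std_normal_density u * exp \<bar>q\<bar>)) * emeasure lborel (I q) =
        ennreal (K * (std_normal_density q * (exp \<bar>q\<bar> * \<bar>q\<bar>)))"
      by (simp add: ennreal_mult[symmetric] K_def mult_ac)
    also have "\<dots> \<le> ennreal (K * (exp 4 * sqrt 2)) * ennreal (normal_density 0 (sqrt 2) q)"
      using le K by (simp add: ennreal_mult[symmetric] ennreal_leI)
    finally show "ennreal (std_normal_density q * (std_normal_density u * exp \<bar>q\<bar>)) * emeasure lborel (I q) \<le>
        ennreal (K * (exp 4 * sqrt 2)) * ennreal (normal_density 0 (sqrt 2) q)" .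
  qed
  also have "\<dots> = ennreal (K * (exp 4 * sqrt 2)) * (\<integral>\<^sup>+q. ennreal (normal_density 0 (sqrt 2) q) \<partial>lborel)"
    by (rule nn_integral_cmult) simp
  also have "(\<integral>\<^sup>+q. ennreal (normal_density 0 (sqrt 2) q) \<partial>lborel) = 1"
    by (subst nn_integral_eq_integral) auto
  finally have "measure std_normal_pair A \<le> K * (exp 4 * sqrt 2)"
    using K by (simp add: std_normal_pair.emeasure_eq_measure)
  then show ?thesis by (simp add: A_def K_def mult_ac)
qed

text \<open>
  Rotating by the mean angle \<open>m\<close> of the two directions decouples half-sum and half-difference: the
  two variables become \<open>\<sigma> P \<mp> \<delta> Q\<close> with independent \<open>P\<close>, \<open>Q\<close>, where \<open>\<sigma>\<close> and \<open>\<delta>\<close> are cosine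
  and sine of half the angle between the directions, so \<open>\<sigma>\<^sup>2 = (1 + \<rho>) / 2\<close> and
  \<open>\<delta>\<^sup>2 = (1 - \<rho>) / 2\<close>.
\<close>

lemma discordance_probability:
  fixes \<alpha> \<beta> u :: real
  defines "\<rho> \<equiv> cos (\<alpha> - \<beta>)"
  assumes \<rho>: "0 \<le> \<rho>" and u: "0 \<le> u" and small: "u * sqrt (1 - \<rho>) \<le> 1"
  shows "measure std_normal_pair {z. fst (rotation \<alpha> z) \<le> u \<and> u < fst (rotation \<beta> z)}
    \<le> 2 * sqrt 2 * exp 4 * sqrt (1 - \<rho>) * std_normal_density u"
proof -
  define m h where "m = (\<alpha> + \<beta>) / 2" and "h = (\<beta> - \<alpha>) / 2"
  define \<sigma> \<delta> where "\<sigma> = cos h" and "\<delta> = sin h"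
  have angles: "\<alpha> = m - h" "\<beta> = m + h" and "\<alpha> - \<beta> = - (2 * h)" by (simp_all add: m_def h_def field_simps)
  have rot: "fst (rotation \<alpha> z) = \<sigma> * fst (rotation m z) - \<delta> * snd (rotation m z)"
      "fst (rotation \<beta> z) = \<sigma> * fst (rotation m z) + \<delta> * snd (rotation m z)" for z
    unfolding angles by (simp_all add: rotation_def \<sigma>_def \<delta>_def split_beta' cos_add cos_diff sin_add sin_diff algebra_simps)
  have sq: "\<sigma>\<^sup>2 + \<delta>\<^sup>2 = 1" by (simp add: \<sigma>_def \<delta>_def)
  have "\<rho> = \<sigma>\<^sup>2 - \<delta>\<^sup>2" using \<open>\<alpha> - \<beta> = - (2 * h)\<close> by (simp add: \<rho>_def \<sigma>_def \<delta>_def cos_double)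
  with sq have \<sigma>2: "\<sigma>\<^sup>2 = (1 + \<rho>) / 2" and \<delta>2: "\<delta>\<^sup>2 = (1 - \<rho>) / 2" by simp_all
  have "\<sigma> \<noteq> 0" using \<sigma>2 \<rho> by auto
  have ratio: "\<bar>\<delta>\<bar> / \<bar>\<sigma>\<bar> \<le> sqrt (1 - \<rho>)"
  proof (rule real_le_rsqrt)
    have "(\<bar>\<delta>\<bar> / \<bar>\<sigma>\<bar>)\<^sup>2 = (1 - \<rho>) / (1 + \<rho>)"
      using \<rho> by (simp add: power_divide \<sigma>2 \<delta>2) (simp add: field_simps)
    also have "\<dots> \<le> (1 - \<rho>) / 1" using \<rho> by (intro divide_left_mono) (auto simp: \<rho>_def)
    also have "\<dots> = 1 - \<rho>" by simp
    finally show "(\<bar>\<delta>\<bar> / \<bar>\<sigma>\<bar>)\<^sup>2 \<le> 1 - \<rho>" .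
  qed
  have "\<bar>\<sigma>\<bar> \<le> 1" by (simp add: \<sigma>_def)
  have "\<bar>\<delta>\<bar> \<le> sqrt (1 - \<rho>)"
    by (rule real_le_rsqrt) (simp add: \<delta>2 \<rho>_def)
  from mult_left_mono[OF this u] small have "u * \<bar>\<delta>\<bar> \<le> 1" by linarith
  have "measure std_normal_pair {z. fst (rotation \<alpha> z) \<le> u \<and> u < fst (rotation \<beta> z)} =
      measure std_normal_pair {z. \<sigma> * fst z - \<delta> * snd z \<le> u \<and> u < \<sigma> * fst z + \<delta> * snd z}"
    unfolding rot by (rule measure_rotation) measurable
  also have "\<dots> \<le> 2 * sqrt 2 * exp 4 * (\<bar>\<delta>\<bar> / \<bar>\<sigma>\<bar>) * std_normal_density u"
    by (rule strip_probability) fact+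
  also have "\<dots> \<le> 2 * sqrt 2 * exp 4 * sqrt (1 - \<rho>) * std_normal_density u"
    using ratio by (intro mult_right_mono mult_left_mono) auto
  finally show ?thesis .
qed

text \<open>
  For \<open>s \<le> t\<close>, the events \<open>X \<le> s\<close> and \<open>X \<le> s, Y \<le> t\<close> differ by a part of the discordance event
  \<open>X \<le> s < Y\<close>; the case \<open>t < s\<close> exchanges the two variables.
\<close>

lemma joint_cdf_near_min:
  assumes M: "prob_space M" and G: "std_bivariate_gaussian M X Y \<rho>" and \<rho>: "0 \<le> \<rho>"
    and u: "0 \<le> min s t" and small: "min s t * sqrt (1 - \<rho>) \<le> 1"
  shows "\<bar>joint_cdf M X Y s t - std_normal_cdf (min s t)\<bar>
    \<le> 2 * sqrt 2 * exp 4 * sqrt (1 - \<rho>) * std_normal_density (min s t)"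
proof -
  have main: "\<bar>measure std_normal_pair {z. fst (rotation \<alpha> z) \<le> s \<and> fst (rotation \<beta> z) \<le> t} - std_normal_cdf s\<bar>
      \<le> 2 * sqrt 2 * exp 4 * sqrt (1 - \<rho>) * std_normal_density s"
    if "cos (\<alpha> - \<beta>) = \<rho>" "s \<le> t" "0 \<le> s" "s * sqrt (1 - \<rho>) \<le> 1" for \<alpha> \<beta> s t
  proof -
    let ?A = "{z. fst (rotation \<alpha> z) \<le> s}" and ?B = "{z. fst (rotation \<alpha> z) \<le> s \<and> fst (rotation \<beta> z) \<le> t}"
    let ?D = "{z. fst (rotation \<alpha> z) \<le> s \<and> s < fst (rotation \<beta> z)}"
    have sets: "?A \<in> sets std_normal_pair" "?B \<in> sets std_normal_pair" "?D \<in> sets std_normal_pair"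
      by (rule sets_std_normal_pair_Collect, simp)+
    have "measure std_normal_pair ?B \<le> measure std_normal_pair ?A"
      using sets by (intro std_normal_pair.finite_measure_mono) auto
    moreover have "measure std_normal_pair ?A \<le> measure std_normal_pair (?B \<union> ?D)"
      using sets \<open>s \<le> t\<close> by (intro std_normal_pair.finite_measure_mono) auto
    moreover have "measure std_normal_pair (?B \<union> ?D) \<le> measure std_normal_pair ?B + measure std_normal_pair ?D"
      using sets by (intro measure_Un_le)
    moreover have "measure std_normal_pair ?D \<le> 2 * sqrt 2 * exp 4 * sqrt (1 - \<rho>) * std_normal_density s"
      using discordance_probability[of \<alpha> \<beta> s] that \<rho> by simp
    ultimately show ?thesis by (simp add: measure_rotation_fst_le abs_le_iff)
  qed
  obtain \<alpha> \<beta> where ang: "cos (\<alpha> - \<beta>) = \<rho>"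
    and F: "\<And>s t. joint_cdf M X Y s t =
      measure std_normal_pair {z. fst (rotation \<alpha> z) \<le> s \<and> fst (rotation \<beta> z) \<le> t}"
    using std_bivariate_gaussian_angles[OF M G] by blast
  show ?thesis
  proof (cases "s \<le> t")
    case True
    then show ?thesis using main[OF ang, of s t] u small by (simp add: F min_def)
  next
    case False
    moreover have "cos (\<beta> - \<alpha>) = \<rho>" using ang cos_minus[of "\<alpha> - \<beta>"] by simp
    ultimately show ?thesis using main[of \<beta> \<alpha> t s] u small by (simp add: F min_def conj_commute)
  qed
qed

section \<open>Powers \<open>(1 - \<tau>\<^sub>n / n)\<^sup>n\<close> to second order\<close>

text \<open>
  With \<open>\<epsilon>\<^sub>n = n ln (1 - \<tau>\<^sub>n / n) + a\<close> the power is \<open>exp (- a) exp \<epsilon>\<^sub>n\<close>. The quadratic error of the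
  logarithm contributes \<open>O(1/n)\<close>, which \<open>w\<^sub>n / n \<longlonglongrightarrow> 0\<close> makes negligible against \<open>1 / w\<^sub>n\<close>; what
  remains is the linear term \<open>a - \<tau>\<^sub>n\<close>, transported by the derivative of \<open>exp\<close> at \<open>0\<close>.
\<close>

lemma power_expansion:
  fixes w \<tau> :: "nat \<Rightarrow> real" and a d :: real
  assumes w: "filterlim w at_top sequentially"
    and wn: "(\<lambda>n. w n / real n) \<longlonglongrightarrow> 0"
    and \<tau>: "(\<lambda>n. w n * (\<tau> n - a)) \<longlonglongrightarrow> d"
  shows "(\<lambda>n. w n * ((1 - \<tau> n / real n) ^ n - exp (- a))) \<longlonglongrightarrow> - d * exp (- a)"
proof -
  have iw: "(\<lambda>n. inverse (w n)) \<longlonglongrightarrow> 0" by (rule tendsto_inverse_0_at_top[OF w])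
  have wpos: "\<forall>\<^sub>F n in sequentially. w n > 0" using w by (simp add: filterlim_at_top_dense)
  have cancel: "g \<longlonglongrightarrow> 0" if "(\<lambda>n. w n * g n) \<longlonglongrightarrow> l" for g :: "nat \<Rightarrow> real" and l
  proof -
    have "(\<lambda>n. inverse (w n) * (w n * g n)) \<longlonglongrightarrow> 0 * l" by (intro tendsto_mult iw that)
    then show ?thesis
      using wpos by (auto elim!: Lim_transform_eventually eventually_mono)
  qed
  have lim_\<tau>: "\<tau> \<longlonglongrightarrow> a" using cancel[OF \<tau>] by (simp add: LIM_zero_iff)
  have lim_\<tau>n: "(\<lambda>n. \<tau> n / real n) \<longlonglongrightarrow> 0"
    by (rule real_tendsto_divide_at_top[OF lim_\<tau> filterlim_real_sequentially])
  define r where "r n = real n * (ln (1 + - (\<tau> n / real n)) - - (\<tau> n / real n))" for n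
  define \<epsilon> where "\<epsilon> n = a - \<tau> n + r n" for n
  have "\<forall>\<^sub>F n in sequentially. \<bar>\<tau> n / real n\<bar> < 1/2"
    using tendstoD[OF lim_\<tau>n, of "1/2"] by (simp add: dist_real_def)
  then have ev: "\<forall>\<^sub>F n in sequentially. \<bar>\<tau> n / real n\<bar> < 1/2 \<and> n > 0 \<and> w n > 0"
    using wpos by (intro eventually_conj eventually_gt_at_top)
  have "(\<lambda>n. w n * r n) \<longlonglongrightarrow> 0"
  proof (rule Lim_null_comparison)
    show "\<forall>\<^sub>F n in sequentially. norm (w n * r n) \<le> 2 * (w n / real n) * (\<tau> n)\<^sup>2"
      using ev
    proof eventually_elim
      case (elim n)
      then have "\<bar>ln (1 + - (\<tau> n / real n)) - - (\<tau> n / real n)\<bar> \<le> 2 * (- (\<tau> n / real n))\<^sup>2"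
        by (intro abs_ln_one_plus_x_minus_x_bound) auto
      then have "w n * real n * \<bar>ln (1 + - (\<tau> n / real n)) - - (\<tau> n / real n)\<bar> \<le> w n * real n * (2 * (- (\<tau> n / real n))\<^sup>2)"
        using elim by (intro mult_left_mono) auto
      also have "\<dots> = 2 * (w n / real n) * (\<tau> n)\<^sup>2" using elim by (simp add: field_simps power2_eq_square)
      finally show ?case using elim by (simp add: r_def abs_mult)
    qed
    have "(\<lambda>n. 2 * (w n / real n) * (\<tau> n)\<^sup>2) \<longlonglongrightarrow> 2 * 0 * a\<^sup>2" by (intro tendsto_intros wn lim_\<tau>)
    then show "(\<lambda>n. 2 * (w n / real n) * (\<tau> n)\<^sup>2) \<longlonglongrightarrow> 0" by simp
  qed
  from tendsto_diff[OF this \<tau>] have w\<epsilon>: "(\<lambda>n. w n * \<epsilon> n) \<longlonglongrightarrow> - d"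
    by (simp add: \<epsilon>_def algebra_simps)
  from cancel[OF this] have lim_\<epsilon>: "\<epsilon> \<longlonglongrightarrow> 0" .
  have "(\<lambda>n. w n * (exp (\<epsilon> n) - 1)) \<longlonglongrightarrow> - d"
  proof (rule tendsto_sandwich[OF _ _ w\<epsilon>])
    show "\<forall>\<^sub>F n in sequentially. w n * \<epsilon> n \<le> w n * (exp (\<epsilon> n) - 1)"
      using wpos
    proof eventually_elim
      case (elim n)
      show ?case
        using exp_ge_add_one_self[of "\<epsilon> n"] elim by (intro mult_left_mono) linarith+
    qed
    show "\<forall>\<^sub>F n in sequentially. w n * (exp (\<epsilon> n) - 1) \<le> w n * \<epsilon> n * exp (\<epsilon> n)"
      using wpos
    proof eventually_elim
      case (elim n)
      have "(1 - \<epsilon> n) * exp (\<epsilon> n) \<le> exp (- \<epsilon> n) * exp (\<epsilon> n)"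
        using exp_ge_add_one_self[of "- \<epsilon> n"] by (intro mult_right_mono) auto
      then have "exp (\<epsilon> n) - 1 \<le> \<epsilon> n * exp (\<epsilon> n)"
        by (simp add: exp_minus algebra_simps)
      then show ?case using elim by (simp add: mult.assoc)
    qed
    have "(\<lambda>n. w n * \<epsilon> n * exp (\<epsilon> n)) \<longlonglongrightarrow> - d * exp 0" by (intro tendsto_intros w\<epsilon> lim_\<epsilon>)
    then show "(\<lambda>n. w n * \<epsilon> n * exp (\<epsilon> n)) \<longlonglongrightarrow> - d" by simp
  qed
  then have "(\<lambda>n. w n * (exp (\<epsilon> n) - 1) * exp (- a)) \<longlonglongrightarrow> - d * exp (- a)"
    by (intro tendsto_intros)
  then show ?thesis
  proof (rule Lim_transform_eventually)
    show "\<forall>\<^sub>F n in sequentially. w n * (exp (\<epsilon> n) - 1) * exp (- a) =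
        w n * ((1 - \<tau> n / real n) ^ n - exp (- a))"
      using ev
    proof eventually_elim
      case (elim n)
      then have "1 - \<tau> n / real n > 0" by linarith
      moreover have "\<epsilon> n - a = real n * ln (1 - \<tau> n / real n)"
        using elim by (simp add: \<epsilon>_def r_def algebra_simps)
      ultimately have "exp (\<epsilon> n - a) = (1 - \<tau> n / real n) ^ n"
        by (simp add: exp_of_nat_mult)
      then show ?case by (simp add: algebra_simps exp_diff exp_minus divide_inverse)
    qed
  qed
qed

section \<open>Normal tails along \<open>u = b \<cdot> exp (L / b\<^sup>2)\<close> and their normalising constants\<close>

lemma std_normal_density_ratio:
  assumes w: "w > 0"
  shows "std_normal_density (sqrt w * exp (L / w)) / (sqrt w * exp (L / w)) /
      (std_normal_density (sqrt w) / sqrt w) = exp (- (w/2) * (exp (2*L/w) - 1) - L/w)"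
proof -
  have "(sqrt w * exp (L / w))\<^sup>2 = w * exp (2 * L / w)"
    using w by (simp add: power_mult_distrib exp_double[symmetric])
  then show ?thesis
    using w by (simp add: std_normal_density_def exp_diff exp_minus field_simps)
      (simp add: exp_add[symmetric] exp_diff[symmetric] field_simps)
qed

text \<open>
  This is the source of the second-order term, written with \<open>w = b\<^sup>2\<close>. The ratio of the leading
  factors \<open>\<phi>(t) / t\<close> is \<open>exp (- (w/2) (exp (2 L / w) - 1) - L / w)\<close>, and its exponent expands to
  \<open>- L - (L\<^sup>2 + L) / w + O(1 / w\<^sup>2)\<close>. The corrections \<open>1 - 1/t\<^sup>2\<close> at the two points agree up to
  \<open>O(1 / w\<^sup>2)\<close> because \<open>u\<^sup>2\<close> and \<open>b\<^sup>2\<close> differ by a bounded amount, so they cancel to the order needed.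
\<close>

lemma tail_ratio_expansion:
  "((\<lambda>w. w * ((1 - std_normal_cdf (sqrt w * exp (L / w))) / (1 - std_normal_cdf (sqrt w)) - exp (- L)))
     \<longlongrightarrow> - (L\<^sup>2 + L) * exp (- L)) at_top"
proof -
  define R where "R w = exp (- (w/2) * (exp (2*L/w) - 1) - L/w)" for w
  define v where "v w = w * exp (2*L/w)" for w
  define lo hi where "lo w = R w * ((1 - 1/v w) / (1 - 1/w + 3/w\<^sup>2))"
    and "hi w = R w * ((1 - 1/v w + 3/(v w)\<^sup>2) / (1 - 1/w))" for w
  define Q where "Q w = (1 - std_normal_cdf (sqrt w * exp (L / w))) / (1 - std_normal_cdf (sqrt w))" for w
  have lo_lim: "((\<lambda>w. w * (lo w - exp (- L))) \<longlongrightarrow> - (L\<^sup>2 + L) * exp (- L)) at_top"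
    unfolding lo_def R_def v_def by (real_asymp simp: field_simps power2_eq_square)
  have hi_lim: "((\<lambda>w. w * (hi w - exp (- L))) \<longlongrightarrow> - (L\<^sup>2 + L) * exp (- L)) at_top"
    unfolding hi_def R_def v_def by (real_asymp simp: field_simps power2_eq_square)
  have bounds: "\<forall>\<^sub>F w in at_top. lo w \<le> Q w \<and> Q w \<le> hi w \<and> w > 0"
  proof -
    have "\<forall>\<^sub>F w in at_top. v w > 4" unfolding v_def by real_asymp
    then show ?thesis using eventually_gt_at_top[of 4]
    proof eventually_elim
      case (elim w)
      define t u where "t = sqrt w" and "u = sqrt w * exp (L / w)"
      have t: "t > 2" "t\<^sup>2 = w" using elim real_less_rsqrt[of 2 w] by (auto simp: t_def)
      have u2: "u\<^sup>2 = v w"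
        using elim by (simp add: u_def v_def power_mult_distrib exp_double[symmetric])
      have "u > 0" using elim by (simp add: u_def)
      then have u: "u > 2" using u2 elim power2_less_imp_less[of 2 u] by simp
      have upper: "1 - std_normal_cdf x \<le> std_normal_density x / x * (1 - 1/x\<^sup>2 + 3/(x\<^sup>2)\<^sup>2)"
        and lower: "std_normal_density x / x * (1 - 1/x\<^sup>2) \<le> 1 - std_normal_cdf x"
        if "x > 2" for x :: real
      proof -
        have "std_normal_density x / x * (1 - 1/x\<^sup>2 + 3/(x\<^sup>2)\<^sup>2) = std_normal_density x * (1/x - 1/x^3 + 3/x^5)"
          "std_normal_density x / x * (1 - 1/x\<^sup>2) = std_normal_density x * (1/x - 1/x^3)"
          using that by (simp_all add: field_simps power_numeral_reduce)
        then show "1 - std_normal_cdf x \<le> std_normal_density x / x * (1 - 1/x\<^sup>2 + 3/(x\<^sup>2)\<^sup>2)"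
          and "std_normal_density x / x * (1 - 1/x\<^sup>2) \<le> 1 - std_normal_cdf x"
          using std_normal_tail_upper[of x] std_normal_tail_lower[of x] that by simp_all
      qed
      define A B where "A = std_normal_density u / u" and "B = std_normal_density t / t"
      have pos: "A > 0" "B > 0" using t u by (simp_all add: A_def B_def normal_density_pos)
      have R: "R w = A / B"
        using std_normal_density_ratio[of w L] elim by (simp add: R_def A_def B_def u_def t_def)
      have wv: "1 - 1 / w > 0" "1 - 1 / v w > 0" using elim by (simp_all add: divide_less_eq)
      note ub = upper[OF u, folded A_def, unfolded u2] lower[OF u, folded A_def, unfolded u2]
      note tb = upper[OF t(1), folded B_def, unfolded t(2)] lower[OF t(1), folded B_def, unfolded t(2)]
      have "B * (1 - 1/w) > 0" using pos wv by simp
      with tb have tpos: "1 - std_normal_cdf t > 0" by linarith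
      have upos: "1 - std_normal_cdf u \<ge> 0" using ub pos wv by (smt (verit) mult_pos_pos)
      have Q: "Q w = (1 - std_normal_cdf u) / (1 - std_normal_cdf t)" by (simp add: Q_def u_def t_def)
      have "lo w = (A * (1 - 1/v w)) / (B * (1 - 1/w + 3/w\<^sup>2))" by (simp add: lo_def R)
      also have "\<dots> \<le> Q w"
        unfolding Q using ub tb tpos upos pos wv by (intro frac_le) auto
      finally have "lo w \<le> Q w" .
      have "Q w \<le> (A * (1 - 1/v w + 3/(v w)\<^sup>2)) / (B * (1 - 1/w))"
        unfolding Q using ub tb tpos upos pos wv by (intro frac_le) auto
      also have "\<dots> = hi w" by (simp add: hi_def R)
      finally have "Q w \<le> hi w" .
      with \<open>lo w \<le> Q w\<close> elim show ?case by simp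
    qed
  qed
  have "((\<lambda>w. w * (Q w - exp (- L))) \<longlongrightarrow> - (L\<^sup>2 + L) * exp (- L)) at_top"
  proof (rule tendsto_sandwich[OF _ _ lo_lim hi_lim])
    show "\<forall>\<^sub>F w in at_top. w * (lo w - exp (- L)) \<le> w * (Q w - exp (- L))"
      using bounds by eventually_elim simp
    show "\<forall>\<^sub>F w in at_top. w * (Q w - exp (- L)) \<le> w * (hi w - exp (- L))"
      using bounds by eventually_elim simp
  qed
  then show ?thesis unfolding Q_def .
qed

text \<open>
  The tail at a fixed point is positive, hence eventually larger than the tail \<open>1 / n\<close> at \<open>b n\<close>.
\<close>

lemma quantile_filterlim_at_top:
  assumes b: "\<And>n. n \<ge> n0 \<Longrightarrow> real n * (1 - std_normal_cdf (b n)) = 1"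
  shows "filterlim b at_top sequentially"
  unfolding filterlim_at_top_ge[where c = 2]
proof (intro allI impI)
  fix K :: real assume K: "K \<ge> 2"
  have "1/K - 1/K^3 > 0" using K power_strict_increasing[of 1 3 K] by (simp add: frac_less2)
  then have "std_normal_density K * (1/K - 1/K^3) > 0" by (simp add: normal_density_pos)
  with std_normal_tail_lower[OF K] have pos: "1 - std_normal_cdf K > 0" by linarith
  have "\<forall>\<^sub>F n in sequentially. 1 / real n < 1 - std_normal_cdf K"
    using pos by real_asymp
  then show "\<forall>\<^sub>F n in sequentially. K \<le> b n"
    using eventually_ge_at_top[of n0] eventually_gt_at_top[of 0]
  proof eventually_elim
    case (elim n)
    have "1 - std_normal_cdf (b n) = 1 / real n" using b[of n] elim by (simp add: field_simps)
    with elim have "std_normal_cdf K < std_normal_cdf (b n)" by simp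
    then show "K \<le> b n"
      using finite_borel_measure.cdf_nondecreasing[of std_normal_distribution "b n" K]
        std_normal.finite_borel_measure_M
      by (fastforce simp: std_normal_cdf_def)
  qed
qed

text \<open>
  The first bound converts the density in the discordance estimate into a power of \<open>b\<close>; the second
  makes \<open>b\<^sup>2 / n\<close> tend to \<open>0\<close>.
\<close>

lemma quantile_density_bound:
  assumes b: "b \<ge> 2" and q: "real n * (1 - std_normal_cdf b) = 1"
  shows "real n * std_normal_density b \<le> 2 * b" "1 / real n \<le> std_normal_density b"
proof -
  have n: "real n > 0" using q by (cases n) auto
  have tail: "1 - std_normal_cdf b = 1 / real n" using q n by (simp add: field_simps)
  have "b^2 \<ge> 4" using b power_mono[of 2 b 2] by simp
  then have "1/2 \<le> 1 - 1 / b^2" using b by (simp add: field_simps)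
  then have "(1/b) * (1/2) \<le> (1/b) * (1 - 1 / b^2)" using b by (intro mult_left_mono) auto
  also have "\<dots> = 1/b - 1/b^3" using b by (simp add: field_simps power_numeral_reduce)
  finally have "std_normal_density b * ((1/b) * (1/2)) \<le> std_normal_density b * (1/b - 1/b^3)"
    by (rule mult_left_mono) simp
  also have "\<dots> \<le> 1 / real n" using std_normal_tail_lower[OF b] tail by simp
  finally show "real n * std_normal_density b \<le> 2 * b" using n b by (simp add: field_simps)
  have "1/b - 1/b^3 + 3/b^5 \<le> 1"
  proof -
    have "3 / b^5 \<le> 1 / b^3"
      using \<open>b^2 \<ge> 4\<close> b by (simp add: field_simps power_numeral_reduce)
    moreover have "1 / b \<le> 1" using b by simp
    ultimately show ?thesis by linarith
  qed
  then have "std_normal_density b * (1/b - 1/b^3 + 3/b^5) \<le> std_normal_density b * 1"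
    by (rule mult_left_mono) simp
  then show "1 / real n \<le> std_normal_density b" using std_normal_tail_upper[of b] tail b by simp
qed

text \<open>
  The point \<open>b exp (L / b\<^sup>2)\<close> is \<open>b x powr (1 / b\<^sup>2)\<close> with \<open>L = ln x\<close>. By convexity of \<open>exp\<close> its
  square is at least \<open>b\<^sup>2 + 2 L\<close>, without any restriction on the sign of \<open>L\<close>.
\<close>

lemma std_normal_density_stretch:
  assumes b: "b > 0"
  shows "std_normal_density (b * exp (L / b\<^sup>2)) \<le> std_normal_density b * exp (- L)"
proof -
  have "(b * exp (L / b\<^sup>2))\<^sup>2 = b\<^sup>2 * exp (2 * L / b\<^sup>2)"
    by (simp add: power_mult_distrib exp_double[symmetric])
  also have "\<dots> \<ge> b\<^sup>2 * (1 + 2 * L / b\<^sup>2)"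
    using exp_ge_add_one_self[of "2 * L / b\<^sup>2"] by (intro mult_left_mono) auto
  also have "b\<^sup>2 * (1 + 2 * L / b\<^sup>2) = b\<^sup>2 + 2 * L" using b by (simp add: field_simps)
  finally have "exp (- (b * exp (L / b\<^sup>2))\<^sup>2 / 2) \<le> exp (- b\<^sup>2 / 2 + - L)" by simp
  also have "\<dots> = exp (- b\<^sup>2 / 2) * exp (- L)" by (rule exp_add)
  finally show ?thesis unfolding std_normal_density_def mult.assoc by (intro mult_left_mono) auto
qed

section \<open>The second-order limit of the normalised maxima\<close>

theorem theorem2p4:
  fixes M :: "'a measure"
    and X Y :: "nat \<Rightarrow> nat \<Rightarrow> 'a \<Rightarrow> real"
    and \<rho> b :: "nat \<Rightarrow> real"
    and F :: "nat \<Rightarrow> real \<Rightarrow> real \<Rightarrow> real"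
  assumes array: "gaussian_triangular_array M X Y \<rho>"
    and F: "\<And>n s t. n \<ge> 1 \<Longrightarrow> F n s t = joint_cdf M (X n 1) (Y n 1) s t"
    and b: "\<And>n. n \<ge> 3 \<Longrightarrow> real n * (1 - std_normal_cdf (b n)) = 1"
    and rho: "\<And>n. n \<ge> 1 \<Longrightarrow> \<rho> n \<in> {0<..1}"
    and lim: "(\<lambda>n. b n ^ 6 * (1 - \<rho> n)) \<longlonglongrightarrow> 0"
  shows "\<forall>x>0. \<forall>y>0.
    (\<lambda>n. (b n)\<^sup>2 *
        (F n (b n * x powr (1 / (b n)\<^sup>2)) (b n * y powr (1 / (b n)\<^sup>2)) ^ n - H0 (ln x) (ln y)))
      \<longlonglongrightarrow> s_fun (min x y) * H0 (ln x) (ln y)"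
proof (intro allI impI)
  fix x y :: real assume x: "x > 0" and y: "y > 0"
  define L where "L = ln (min x y)"
  have L: "L = min (ln x) (ln y)" using x y by (auto simp: L_def min_def)
  define w where "w n = (b n)\<^sup>2" for n
  define u where "u n = b n * exp (L / w n)" for n
  define s t where "s n = b n * x powr (1 / (b n)\<^sup>2)" and "t n = b n * y powr (1 / (b n)\<^sup>2)" for n
  define \<tau> where "\<tau> n = real n * (1 - F n (s n) (t n))" for n
  have b_top: "filterlim b at_top sequentially" by (rule quantile_filterlim_at_top[OF b])
  then have w_top: "filterlim w at_top sequentially"
    unfolding w_def by (rule filterlim_compose[rotated]) real_asymp
  have u_ratio: "((\<lambda>n. u n / b n) \<longlonglongrightarrow> 1)"
  proof -
    have "((\<lambda>n. exp (L / w n)) \<longlonglongrightarrow> exp 0)"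
      by (intro tendsto_exp real_tendsto_divide_at_top[OF tendsto_const w_top])
    moreover have "\<forall>\<^sub>F n in sequentially. exp (L / w n) = u n / b n"
      using filterlim_at_top_dense[THEN iffD1, OF b_top, rule_format, of 0]
      by eventually_elim (simp add: u_def)
    ultimately show ?thesis by (auto elim: Lim_transform_eventually)
  qed
  have \<rho>_lim: "(\<lambda>n. b n ^ 3 * sqrt (1 - \<rho> n)) \<longlonglongrightarrow> 0"
  proof -
    have "(\<lambda>n. sqrt (b n ^ 6 * (1 - \<rho> n))) \<longlonglongrightarrow> sqrt 0" by (intro tendsto_real_sqrt lim)
    moreover have "\<forall>\<^sub>F n in sequentially. sqrt (b n ^ 6 * (1 - \<rho> n)) = b n ^ 3 * sqrt (1 - \<rho> n)"
      using filterlim_at_top_dense[THEN iffD1, OF b_top, rule_format, of 0]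
    proof eventually_elim
      case (elim n)
      have "sqrt (b n ^ 6) = b n ^ 3"
        using elim by (intro real_sqrt_unique) simp_all
      then show ?case by (simp add: real_sqrt_mult)
    qed
    ultimately show ?thesis by (auto elim: Lim_transform_eventually)
  qed
  define C where "C = 2 * sqrt 2 * exp (4::real)"
  have ev: "\<forall>\<^sub>F n in sequentially. n \<ge> 3 \<and> b n \<ge> 2 \<and> u n / b n < 2 \<and> b n ^ 3 * sqrt (1 - \<rho> n) < 1"
    using eventually_ge_at_top[of 3] filterlim_at_top[THEN iffD1, OF b_top, rule_format, of 2]
      order_tendstoD(2)[OF u_ratio, of 2] order_tendstoD(2)[OF \<rho>_lim, of 1]
    by (auto intro!: eventually_conj)
  \<comment> \<open>Replacing the pair by one variable costs \<open>b\<^sup>2 \<cdot> n \<cdot> O(sqrt (1 - \<rho>) \<phi>(u))\<close>, and \<open>n \<phi>(u) = O(b)\<close>.\<close>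
  have key: "\<forall>\<^sub>F n in sequentially. \<bar>w n * (\<tau> n - real n * (1 - std_normal_cdf (u n)))\<bar> \<le>
      2 * C * exp (- L) * (b n ^ 3 * sqrt (1 - \<rho> n))"
    using ev
  proof eventually_elim
    case (elim n)
    then have n: "n \<ge> 1" and bn: "b n > 0" by auto
    have st: "min (s n) (t n) = u n"
    proof -
      have "s n = b n * exp (ln x / w n)" "t n = b n * exp (ln y / w n)"
        using x y by (simp_all add: s_def t_def w_def powr_def)
      then show ?thesis
        using bn by (auto simp: u_def L min_def w_def divide_right_mono frac_le_eq field_simps not_le)
    qed
    have u: "0 \<le> u n" using bn by (simp add: u_def)
    have small: "u n * sqrt (1 - \<rho> n) \<le> 1"
    proof -
      have "u n \<le> 2 * b n" using elim bn by (simp add: divide_less_eq)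
      also have "2 * b n \<le> (b n)\<^sup>2 * b n"
        using elim power_mono[of 2 "b n" 2] by (intro mult_right_mono) auto
      also have "\<dots> = b n ^ 3" by (simp add: power_numeral_reduce)
      finally have "u n * sqrt (1 - \<rho> n) \<le> b n ^ 3 * sqrt (1 - \<rho> n)"
        using rho[OF n] by (intro mult_right_mono) auto
      then show ?thesis using elim by linarith
    qed
    have "prob_space M" "std_bivariate_gaussian M (X n 1) (Y n 1) (\<rho> n)"
      using array n by (auto simp: gaussian_triangular_array_def)
    from joint_cdf_near_min[OF this, of "s n" "t n"] rho[OF n] u small
    have "\<bar>F n (s n) (t n) - std_normal_cdf (u n)\<bar> \<le> C * sqrt (1 - \<rho> n) * std_normal_density (u n)"
      by (simp add: st F[OF n] C_def)
    also have "\<dots> \<le> C * sqrt (1 - \<rho> n) * (std_normal_density (b n) * exp (- L))"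
      using std_normal_density_stretch[OF bn, of L] rho[OF n]
      by (intro mult_left_mono) (auto simp: C_def u_def w_def)
    finally have "real n * \<bar>F n (s n) (t n) - std_normal_cdf (u n)\<bar> \<le>
        C * sqrt (1 - \<rho> n) * exp (- L) * (real n * std_normal_density (b n))"
      using n by (simp add: mult_ac mult_le_cancel_left)
    also have "\<dots> \<le> C * sqrt (1 - \<rho> n) * exp (- L) * (2 * b n)"
      using quantile_density_bound(1)[of "b n" n] elim b[of n] rho[OF n]
      by (intro mult_left_mono) (auto simp: C_def)
    finally have "w n * (real n * \<bar>F n (s n) (t n) - std_normal_cdf (u n)\<bar>) \<le>
        w n * (C * sqrt (1 - \<rho> n) * exp (- L) * (2 * b n))"
      by (rule mult_left_mono) (simp add: w_def)
    also have "\<dots> = 2 * C * exp (- L) * (b n ^ 3 * sqrt (1 - \<rho> n))"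
      by (simp add: w_def power_numeral_reduce mult_ac)
    also have "w n * (real n * \<bar>F n (s n) (t n) - std_normal_cdf (u n)\<bar>) =
        \<bar>w n * (\<tau> n - real n * (1 - std_normal_cdf (u n)))\<bar>"
      by (simp add: \<tau>_def w_def right_diff_distrib[symmetric] abs_mult abs_minus_commute)
    finally show ?case .
  qed
  have dep: "(\<lambda>n. w n * (\<tau> n - real n * (1 - std_normal_cdf (u n)))) \<longlonglongrightarrow> 0"
  proof (rule Lim_null_comparison)
    show "\<forall>\<^sub>F n in sequentially. norm (w n * (\<tau> n - real n * (1 - std_normal_cdf (u n)))) \<le>
      2 * C * exp (- L) * (b n ^ 3 * sqrt (1 - \<rho> n))" using key by simp
    show "(\<lambda>n. 2 * C * exp (- L) * (b n ^ 3 * sqrt (1 - \<rho> n))) \<longlonglongrightarrow> 0"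
      using tendsto_mult_right_zero[OF \<rho>_lim] by simp
  qed
  \<comment> \<open>Since \<open>n = 1 / (1 - \<Phi>(b n))\<close>, the marginal part of \<open>\<tau>\<close> is a ratio of two tails.\<close>
  have marg: "(\<lambda>n. w n * (real n * (1 - std_normal_cdf (u n)) - exp (- L))) \<longlonglongrightarrow> - (L\<^sup>2 + L) * exp (- L)"
    using filterlim_compose[OF tail_ratio_expansion[of L] w_top]
  proof (rule Lim_transform_eventually)
    show "\<forall>\<^sub>F n in sequentially. w n * ((1 - std_normal_cdf (sqrt (w n) * exp (L / w n))) / (1 - std_normal_cdf (sqrt (w n))) - exp (- L)) =
        w n * (real n * (1 - std_normal_cdf (u n)) - exp (- L))"
      using ev
    proof eventually_elim
      case (elim n)
      then have "1 - std_normal_cdf (b n) = 1 / real n" using b[of n] by (simp add: field_simps)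
      moreover have "sqrt (w n) = b n" using elim by (simp add: w_def)
      ultimately show ?case by (simp add: u_def mult.commute)
    qed
  qed
  have "(\<lambda>n. w n * (\<tau> n - exp (- L))) \<longlonglongrightarrow> - (L\<^sup>2 + L) * exp (- L)"
    using tendsto_add[OF dep marg] by (simp add: algebra_simps)
  moreover have "(\<lambda>n. w n / real n) \<longlonglongrightarrow> 0"
  proof (rule Lim_null_comparison)
    show "\<forall>\<^sub>F n in sequentially. norm (w n / real n) \<le> (b n)\<^sup>2 * std_normal_density (b n)"
      using ev
    proof eventually_elim
      case (elim n)
      then have "(b n)\<^sup>2 * (1 / real n) \<le> (b n)\<^sup>2 * std_normal_density (b n)"
        using quantile_density_bound(2)[of "b n" n] b[of n] by (intro mult_left_mono) auto
      then show ?case by (simp add: w_def)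
    qed
    have "((\<lambda>z. z\<^sup>2 * std_normal_density z) \<longlongrightarrow> 0) at_top"
      unfolding normal_density_def by real_asymp
    then show "(\<lambda>n. (b n)\<^sup>2 * std_normal_density (b n)) \<longlonglongrightarrow> 0"
      by (rule filterlim_compose[OF _ b_top])
  qed
  ultimately have "(\<lambda>n. w n * ((1 - \<tau> n / real n) ^ n - exp (- exp (- L)))) \<longlonglongrightarrow>
      - (- (L\<^sup>2 + L) * exp (- L)) * exp (- exp (- L))"
    by (intro power_expansion w_top)
  moreover have "- (- (L\<^sup>2 + L) * exp (- L)) * exp (- exp (- L)) = s_fun (min x y) * H0 (ln x) (ln y)"
    using x y by (simp add: s_fun_def H0_def L[symmetric]) (simp add: L_def exp_minus algebra_simps)
  moreover have "\<forall>\<^sub>F n in sequentially. w n * ((1 - \<tau> n / real n) ^ n - exp (- exp (- L))) =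
      (b n)\<^sup>2 * (F n (b n * x powr (1 / (b n)\<^sup>2)) (b n * y powr (1 / (b n)\<^sup>2)) ^ n - H0 (ln x) (ln y))"
    using eventually_gt_at_top[of 0]
    by eventually_elim (simp add: w_def \<tau>_def s_def t_def H0_def L)
  ultimately show "(\<lambda>n. (b n)\<^sup>2 *
        (F n (b n * x powr (1 / (b n)\<^sup>2)) (b n * y powr (1 / (b n)\<^sup>2)) ^ n - H0 (ln x) (ln y)))
      \<longlonglongrightarrow> s_fun (min x y) * H0 (ln x) (ln y)"
    by (auto elim: Lim_transform_eventually)
qed

end
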